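(* Let $p \geq 5$ be a prime. For an abelian group $G$ and $A \subseteq G$ write $\hat{2}A = \{a_1 + a_2 \mid a_1, a_2 \in A,\ a_1 \neq a_2\}$, and let $\rho(G, m) = \min\{|\hat{2}A| \mid A \subseteq G,\ |A| = m\}$. Then $\rho(\mathbb{Z}_p^2, 2p+1) = 4p$.
   Context: $\mathbb{Z}_p^2$ denotes the additive group $\mathbb{Z}/p\mathbb{Z} \times \mathbb{Z}/p\mathbb{Z}$. *)

theory Defs
  imports "HOL-Algebra.Elementary_Groups" "HOL-Computational_Algebra.Primes"
begin

definition restricted_sumset :: "('a, 'b) monoid_scheme \<Rightarrow> 'a set \<Rightarrow> 'a set" where
  "restricted_sumset G A = {a1 \<otimes>\<^bsub>G\<^esub> a2 | a1 a2. a1 \<in> A \<and> a2 \<in> A \<and> a1 \<noteq> a2}"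

(* For fixed m the candidate values are at most m^2, so the set below is finite even if G is
   infinite. It is nonempty, so that Min is the actual minimum, iff G has an m-element subset. *)
definition rho :: "('a, 'b) monoid_scheme \<Rightarrow> nat \<Rightarrow> nat" where
  "rho G m = Min {card (restricted_sumset G A) | A. A \<subseteq> carrier G \<and> finite A \<and> card A = m}"

lemma finite_restricted_sumset:
  assumes "finite A"
  shows "finite (restricted_sumset G A)" "card (restricted_sumset G A) \<le> card A ^ 2"
proof -
  have sub: "restricted_sumset G A \<subseteq> (\<lambda>(a1, a2). a1 \<otimes>\<^bsub>G\<^esub> a2) ` (A \<times> A)"
    by (auto simp: restricted_sumset_def)
  show "finite (restricted_sumset G A)"
    using sub assms by (meson finite_SigmaI finite_imageI finite_subset)
  have "card (restricted_sumset G A) \<le> card (A \<times> A)"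
    using surj_card_le[OF _ sub] assms by simp
  then show "card (restricted_sumset G A) \<le> card A ^ 2"
    by (simp add: card_cartesian_product power2_eq_square)
qed

lemma finite_rho_values:
  "finite {card (restricted_sumset G A) | A. A \<subseteq> carrier G \<and> finite A \<and> card A = m}"
proof (rule finite_subset)
  show "{card (restricted_sumset G A) | A. A \<subseteq> carrier G \<and> finite A \<and> card A = m} \<subseteq> {..m ^ 2}"
    using finite_restricted_sumset(2) by blast
qed simp

abbreviation Zp2 :: "nat \<Rightarrow> (int \<times> int) monoid" where
  "Zp2 p \<equiv> integer_mod_group p \<times>\<times> integer_mod_group p"

lemma comm_group_Zp2: "comm_group (Zp2 p)"
  by (rule group.group_comm_groupI) (auto simp: DirProd_group add.commute)

end

theory Submission
  imports Defs "HOL-Number_Theory.Cong"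
begin

text \<open>Upper bound: two parallel lines and one further point.

  Lower bound: fix a direction and let \<open>a\<^sub>i\<close> and \<open>c\<^sub>k\<close> be the sizes of the fibres of \<open>A\<close> and of its
  restricted sumset over the lines in that direction. Cauchy--Davenport gives
  \<open>c\<^bsub>i+j\<^esub> \<ge> min p (a\<^sub>i + a\<^sub>j - 1)\<close> for \<open>i \<noteq> j\<close> if both fibres are nonempty, and \<open>c\<^bsub>2i\<^esub> \<ge> a\<^sub>i\<close> holds
  as soon as \<open>a\<^sub>i \<ge> 3\<close>. These inequalities alone force \<open>\<Sum> c\<^sub>k \<ge> 4p\<close>, unless one line
  contains 3 points of \<open>A\<close> and all others contain 2. By counting collinear pairs, this cannot happen
  in every direction.\<close>

section \<open>Sumsets modulo a prime\<close>

locale prime_ge_5 =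
  fixes p :: nat
  assumes prime: "Factorial_Ring.prime p" and p_ge_5: "5 \<le> p"
begin

abbreviation Z :: "int set" where "Z \<equiv> {0..<int p}"

definition sums :: "int set \<Rightarrow> int set \<Rightarrow> int set" where
  "sums A B = {(a + b) mod int p | a b. a \<in> A \<and> b \<in> B}"

definition distinct_sums :: "int set \<Rightarrow> int set" where
  "distinct_sums A = {(a + b) mod int p | a b. a \<in> A \<and> b \<in> A \<and> a \<noteq> b}"

lemma mod_in_Z [simp]: "0 \<le> x mod int p" "x mod int p < int p"
  using p_ge_5 by auto

lemma sums_subset: "sums A B \<subseteq> Z"
  by (auto simp: sums_def)

lemma distinct_sums_subset: "distinct_sums A \<subseteq> Z"
  by (auto simp: distinct_sums_def)

section \<open>Translates, reflections and multiples of residues\<close>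

lemma eq_if_dvd_diff:
  assumes "x \<in> Z" "y \<in> Z" "int p dvd x - y"
  shows "x = y"
  using assms by (metis atLeastLessThan_iff mod_eq_dvd_iff mod_pos_pos_trivial)

lemma dvd_diff_if_dvd_mult:
  assumes "x \<in> Z" "y \<in> Z" "int p dvd m * (x - y)" "\<not> int p dvd m"
  shows "x = y"
proof -
  have "prime (int p)" using prime by simp
  then show ?thesis using assms eq_if_dvd_diff prime_dvd_mult_iff by blast
qed

lemma inj_on_add: "A \<subseteq> Z \<Longrightarrow> inj_on (\<lambda>x. (x + c) mod int p) A"
  by (rule inj_onI, rule eq_if_dvd_diff) (auto simp: mod_eq_dvd_iff)

lemma inj_on_diff: "A \<subseteq> Z \<Longrightarrow> inj_on (\<lambda>x. (c - x) mod int p) A"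
proof (rule inj_onI, rule eq_if_dvd_diff)
  fix x y assume "(c - x) mod int p = (c - y) mod int p"
  then have "int p dvd (c - y) - (c - x)" by (metis mod_eq_dvd_iff)
  then show "int p dvd x - y" by simp
qed auto

lemma finite_subset_Z: "A \<subseteq> Z \<Longrightarrow> finite A"
  by (rule finite_subset) auto

lemma card_le_p: "A \<subseteq> Z \<Longrightarrow> card A \<le> p"
  using card_mono[of Z A] by simp

lemma eq_Z: "A \<subseteq> Z \<Longrightarrow> p \<le> card A \<Longrightarrow> A = Z"
  by (rule card_subset_eq) (auto simp: card_le_p intro!: antisym)

text \<open>\<open>X\<close> and the reflected set \<open>k - Y\<close> have more than
  \<open>p\<close> elements in total, so they meet.\<close>

lemma pigeonhole:
  assumes "X \<subseteq> Z" "Y \<subseteq> Z" "p < card X + card Y"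
  obtains x y where "x \<in> X" "y \<in> Y" "(x + y) mod int p = k mod int p"
proof -
  let ?Y = "(\<lambda>y. (k - y) mod int p) ` Y"
  have "card ?Y = card Y" by (rule card_image[OF inj_on_diff[OF assms(2)]])
  moreover have "card (X \<union> ?Y) \<le> p" using assms(1) by (intro card_le_p) auto
  moreover have "finite X" "finite ?Y" using assms finite_subset_Z by auto
  ultimately have "X \<inter> ?Y \<noteq> {}"
    using assms(3) card_Un_disjoint[of X ?Y] by force
  then obtain y where "y \<in> Y" "(k - y) mod int p \<in> X" by auto
  then show thesis by (intro that[of "(k - y) mod int p" y]) (auto simp: mod_simps)
qed

lemma ex_mult_cong:
  assumes "\<not> int p dvd d"
  obtains e where "e \<in> Z" "(e * d) mod int p = k mod int p"
proof -
  have "coprime d (int p)"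
    using prime_imp_coprime[of "int p" d] assms prime by (simp add: coprime_commute)
  then obtain u where "(d * u) mod int p = 1 mod int p"
    using cong_solve_coprime_int[of d "int p"] unfolding cong_def by auto
  then have "((d * u) mod int p * k) mod int p = (1 mod int p * k) mod int p" by simp
  then have "(d * u * k) mod int p = k mod int p"
    by (simp add: mod_mult_left_eq del: mod_mult_right_eq)
  then have "((u * k) mod int p * d) mod int p = k mod int p"
    by (simp add: mod_simps ac_simps)
  then show thesis using that[of "(u * k) mod int p"] by simp
qed

text \<open>As \<open>p\<close> is prime, the multiples of \<open>d\<close> reach every residue. In
  Davenport's transform this yields, for a proper subset \<open>A\<close>, an element that leaves
  \<open>A\<close> under a prescribed nonzero shift.\<close>

lemma shift_invariant:
  assumes "A \<subseteq> Z" "A \<noteq> {}" "\<not> int p dvd d"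
    and shift: "\<And>a. a \<in> A \<Longrightarrow> (a + d) mod int p \<in> A"
  shows "A = Z"
proof
  obtain a where a: "a \<in> A" using assms(2) by auto
  have mult: "(a + int n * d) mod int p \<in> A" for n
  proof (induction n)
    case 0
    then show ?case using a assms(1) by auto
  next
    case (Suc n)
    show ?case using shift[OF Suc] by (simp add: mod_simps algebra_simps)
  qed
  show "Z \<subseteq> A"
  proof
    fix k assume k: "k \<in> Z"
    obtain e where e: "e \<in> Z" "(e * d) mod int p = (k - a) mod int p"
      using ex_mult_cong[OF assms(3)] by metis
    have "(a + int (nat e) * d) mod int p = (a + (e * d) mod int p) mod int p"
      using e(1) by (simp add: mod_simps)
    also have "\<dots> = k" using k by (simp add: e(2) mod_simps)
    finally show "k \<in> A" using mult[of "nat e"] by simp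
  qed
qed (use assms in auto)

text \<open>Davenport's transform: \<open>(A, B)\<close> is replaced by \<open>(A \<union> (B + e), B \<inter> (A - e))\<close>, with \<open>e\<close>
  chosen such that the second set becomes smaller but stays nonempty.\<close>

theorem Cauchy_Davenport:
  assumes "A \<subseteq> Z" "B \<subseteq> Z" "A \<noteq> {}" "B \<noteq> {}"
  shows "min p (card A + card B - 1) \<le> card (sums A B)"
  using assms
proof (induction "card B" arbitrary: A B rule: less_induct)
  case less
  have fin: "finite A" "finite B" "finite (sums A B)"
    using less.prems finite_subset_Z sums_subset by auto
  consider "A = Z" | "card B = 1" | "A \<noteq> Z" "card B \<noteq> 1" by auto
  then show ?case
  proof cases
    case 1
    obtain b where "b \<in> B" using less.prems by auto
    then have "(\<lambda>x. (x + b) mod int p) ` A \<subseteq> sums A B" by (auto simp: sums_def)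
    then have "card A \<le> card (sums A B)"
      by (metis card_image card_mono fin(3) inj_on_add less.prems(1))
    then show ?thesis using 1 by simp
  next
    case 2
    then obtain b where "B = {b}" by (auto simp: card_1_singleton_iff)
    then have "(\<lambda>x. (x + b) mod int p) ` A \<subseteq> sums A B" by (auto simp: sums_def)
    then have "card A \<le> card (sums A B)"
      by (metis card_image card_mono fin(3) inj_on_add less.prems(1))
    then show ?thesis using 2 by simp
  next
    case 3
    have "card B \<noteq> 0" using fin less.prems by simp
    then have "\<not> card B \<le> Suc 0" using 3 by simp
    then obtain b b' where b: "b \<in> B" "b' \<in> B" "b \<noteq> b'"
      using card_le_Suc0_iff_eq[OF fin(2)] by auto
    have "\<not> int p dvd b' - b" using b less.prems eq_if_dvd_diff by blast
    then obtain a where a: "a \<in> A" "(a + (b' - b)) mod int p \<notin> A"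
      using shift_invariant[of A "b' - b"] 3 less.prems by blast
    \<comment> \<open>This choice gives \<open>b + e = a\<close>, which lies in \<open>A\<close>, so
      \<open>b\<close> survives in \<open>B'\<close>; but \<open>b' + e\<close> is the shift of
      \<open>a\<close> that leaves \<open>A\<close>, so \<open>b'\<close> is lost.\<close>
    define e where "e = a - b"
    define A' where "A' = A \<union> (\<lambda>x. (x + e) mod int p) ` B"
    define B' where "B' = {x \<in> B. (x + e) mod int p \<in> A}"
    have B': "b \<in> B'" "b' \<notin> B'" "B' \<subseteq> B"
      using a b less.prems by (auto simp: B'_def e_def algebra_simps)
    have A': "A' \<subseteq> Z" using less.prems by (auto simp: A'_def)
    have "card B' < card B" by (rule psubset_card_mono) (use B' b fin in auto)
    moreover have "B' \<noteq> {}" "B' \<subseteq> Z" "A' \<noteq> {}" using B' less.prems by (auto simp: A'_def)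
    ultimately have IH: "min p (card A' + card B' - 1) \<le> card (sums A' B')"
      using A' by (intro less.hyps) auto
    have "sums A' B' \<subseteq> sums A B"
    proof
      fix k assume "k \<in> sums A' B'"
      then obtain x y where xy: "x \<in> A'" "y \<in> B'" "k = (x + y) mod int p"
        by (auto simp: sums_def)
      show "k \<in> sums A B"
      proof (cases "x \<in> A")
        case True
        then show ?thesis using xy by (auto simp: sums_def B'_def)
      next
        case False
        then obtain z where z: "z \<in> B" "x = (z + e) mod int p" using xy by (auto simp: A'_def)
        \<comment> \<open>The shift \<open>e\<close> moves from one summand to the other:
          \<open>y + e\<close> lies in \<open>A\<close> by definition of \<open>B'\<close>, and
          \<open>z\<close> lies in \<open>B\<close>.\<close>
        have "k = ((y + e) mod int p + z) mod int p"
          by (simp add: xy z mod_simps algebra_simps)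
        then show ?thesis using xy z by (auto simp: sums_def B'_def)
      qed
    qed
    then have sub: "card (sums A' B') \<le> card (sums A B)" by (intro card_mono fin)
    let ?C = "(\<lambda>x. (x + e) mod int p) ` B"
    have inj: "inj_on (\<lambda>x. (x + e) mod int p) B" by (rule inj_on_add[OF less.prems(2)])
    have "A \<inter> ?C = (\<lambda>x. (x + e) mod int p) ` B'" by (auto simp: B'_def)
    then have "card (A \<inter> ?C) = card B'"
      using B'(3) inj by (metis card_image inj_on_subset)
    moreover have "card ?C = card B" using inj by (rule card_image)
    \<comment> \<open>Inclusion-exclusion: the transform preserves the total
      \<open>card A + card B\<close>.\<close>
    moreover have "card A + card ?C = card A' + card (A \<inter> ?C)"
      unfolding A'_def using fin by (intro card_Un_Int) auto
    ultimately show ?thesis using IH sub by simp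
  qed
qed

text \<open>If \<open>x + (A - {x})\<close> were the same set for all \<open>x \<in> A\<close>, then so would be the sum
  \<open>(card A - 2) * x + \<Sum>A\<close> of its elements.\<close>

lemma card_le_card_distinct_sums:
  assumes "A \<subseteq> Z" "3 \<le> card A"
  shows "card A \<le> card (distinct_sums A)"
proof (rule ccontr)
  assume less: "\<not> card A \<le> card (distinct_sums A)"
  have fin: "finite A" "finite (distinct_sums A)"
    using assms finite_subset_Z distinct_sums_subset by auto
  define n where "n = int (card A)"
  have translate: "int p dvd \<Sum>(distinct_sums A) - ((n - 2) * x + \<Sum>A)" if x: "x \<in> A" for x
  proof -
    let ?f = "\<lambda>y. (y + x) mod int p"
    have inj: "inj_on ?f (A - {x})" using assms by (intro inj_on_add) auto
    have "?f ` (A - {x}) \<subseteq> distinct_sums A" using x by (auto simp: distinct_sums_def)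
    moreover have "card (?f ` (A - {x})) = card A - 1" using card_image[OF inj] x by simp
    \<comment> \<open>The translate already has \<open>card A - 1\<close> elements, the most that
      the negated goal allows.\<close>
    ultimately have "?f ` (A - {x}) = distinct_sums A"
      using less fin by (intro card_subset_eq) (auto dest: card_mono[rotated])
    then have "\<Sum>(distinct_sums A) = (\<Sum>y\<in>A - {x}. ?f y)"
      using sum.reindex[OF inj, of "\<lambda>y. y"] by simp
    also have "\<dots> mod int p = (\<Sum>y\<in>A - {x}. y + x) mod int p" by (simp add: mod_sum_eq)
    also have "(\<Sum>y\<in>A - {x}. y + x) = \<Sum>A - x + (n - 1) * x"
      using x fin assms by (simp add: sum.distrib sum_diff1 n_def of_nat_diff)
    also have "\<dots> = (n - 2) * x + \<Sum>A" by (simp add: algebra_simps)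
    finally show ?thesis by (simp add: mod_eq_dvd_iff)
  qed
  have "\<not> card A \<le> Suc 0" using assms by simp
  then obtain x y where xy: "x \<in> A" "y \<in> A" "x \<noteq> y"
    using card_le_Suc0_iff_eq[OF fin(1)] by auto
  have "int p dvd (\<Sum>(distinct_sums A) - ((n - 2) * y + \<Sum>A)) - (\<Sum>(distinct_sums A) - ((n - 2) * x + \<Sum>A))"
    by (rule dvd_diff) (use translate xy in blast)+
  also have "\<dots> = (n - 2) * (x - y)" by (simp add: algebra_simps)
  finally have "int p dvd (n - 2) * (x - y)" .
  \<comment> \<open>Since \<open>3 \<le> card A \<le> p\<close>, the factor \<open>n - 2\<close>
    lies strictly between 0 and \<open>p\<close>.\<close>
  moreover have "\<not> int p dvd n - 2"
    using assms card_le_p[of A] by (intro zdvd_not_zless) (auto simp: n_def)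
  ultimately show False using xy assms dvd_diff_if_dvd_mult by blast
qed

end

text \<open>Double counting of the pairs \<open>(i, s)\<close> with
  \<open>1 \<le> s \<le> min (f i) n\<close>.\<close>

lemma sum_min_eq_sum_card_layers:
  fixes f :: "'a \<Rightarrow> nat"
  assumes "finite S"
  shows "(\<Sum>i\<in>S. min (f i) n) = (\<Sum>s=1..n. card {i\<in>S. s \<le> f i})"
proof -
  have "min (f i) n = (\<Sum>s=1..n. if s \<le> f i then 1 else 0)" for i
  proof -
    have "(\<Sum>s=1..n. if s \<le> f i then 1 else 0) = card {s\<in>{1..n}. s \<le> f i}"
      by (simp add: sum.If_cases Int_def)
    also have "{s\<in>{1..n}. s \<le> f i} = {1..min (f i) n}" by auto
    finally show ?thesis by simp
  qed
  then have "(\<Sum>i\<in>S. min (f i) n) = (\<Sum>s=1..n. \<Sum>i\<in>S. if s \<le> f i then 1 else 0)"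
    by (simp add: sum.swap[of _ S])
  also have "\<dots> = (\<Sum>s=1..n. card {i\<in>S. s \<le> f i})"
    using assms by (simp add: sum.If_cases Int_def)
  finally show ?thesis .
qed

section \<open>Fibre sizes\<close>

text \<open>Reduces one direction to numbers. The index \<open>i + i\<close> receives only
  restricted sums from within the fibre over \<open>i\<close>, hence the weaker bounds
  \<open>c_double\<close> and \<open>c_double'\<close>. The profile 3, 2, ..., 2 is excluded because
  for it the inequalities give only \<open>4 * (p - 1) + 3\<close>.\<close>

locale profile = prime_ge_5 +
  fixes a c :: "int \<Rightarrow> nat"
  assumes sum_a: "(\<Sum>i\<in>Z. a i) = 2 * p + 1"
    and a_le: "i \<in> Z \<Longrightarrow> a i \<le> p"
    and c_add: "\<lbrakk>i \<in> Z; j \<in> Z; i \<noteq> j; 1 \<le> a i; 1 \<le> a j\<rbrakk> \<Longrightarrow> min p (a i + a j - 1) \<le> c ((i + j) mod int p)"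
    and c_double: "i \<in> Z \<Longrightarrow> a i - 1 \<le> c ((i + i) mod int p)"
    and c_double': "i \<in> Z \<Longrightarrow> 3 \<le> a i \<Longrightarrow> a i \<le> c ((i + i) mod int p)"
    and not_flat: "\<not> (\<exists>i\<in>Z. a i = 3 \<and> (\<forall>j\<in>Z - {i}. a j = 2))"
begin

section \<open>Level sets of the fibre sizes\<close>

definition T :: "nat \<Rightarrow> int set" where "T s = {i\<in>Z. s \<le> a i}"

text \<open>The partition conjugate to the fibre sizes.\<close>

abbreviation t :: "nat \<Rightarrow> nat" where "t s \<equiv> card (T s)"

lemma T_subset: "T s \<subseteq> Z"
  by (auto simp: T_def)

lemma finite_T [simp]: "finite (T s)"
  using T_subset finite_subset_Z by blast

lemma T_antimono: "r \<le> s \<Longrightarrow> T s \<subseteq> T r"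
  by (auto simp: T_def)

lemma t_antimono: "r \<le> s \<Longrightarrow> t s \<le> t r"
  by (intro card_mono T_antimono) auto

lemma t_le: "t s \<le> p"
  by (rule card_le_p[OF T_subset])

lemma sum_t:
  assumes "\<And>i. i \<in> Z \<Longrightarrow> a i \<le> n"
  shows "(\<Sum>s=1..n. t s) = 2 * p + 1"
proof -
  have "(\<Sum>s=1..n. t s) = (\<Sum>i\<in>Z. min (a i) n)"
    by (simp add: sum_min_eq_sum_card_layers T_def)
  also have "\<dots> = (\<Sum>i\<in>Z. a i)"
    using assms by (intro sum.cong) (auto simp: min_def)
  finally show ?thesis using sum_a by simp
qed

lemma sum_T1: "(\<Sum>i\<in>T 1. a i) = 2 * p + 1"
  unfolding sum_a[symmetric] by (rule sum.mono_neutral_left) (auto simp: T_def)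

lemma c_ge:
  assumes "i \<in> T r" "j \<in> T s" "i \<noteq> j" "1 \<le> r" "1 \<le> s" "r + s \<le> p + 1"
  shows "r + s - 1 \<le> c ((i + j) mod int p)"
proof -
  have "min p (a i + a j - 1) \<le> c ((i + j) mod int p)"
    using assms by (intro c_add) (auto simp: T_def)
  moreover have "r + s - 1 \<le> min p (a i + a j - 1)" using assms by (auto simp: T_def)
  ultimately show ?thesis by (rule le_trans[rotated])
qed

text \<open>Cauchy--Davenport is applied a second time, now to indices of lines: adding a nonempty
  fibre to one of size at least \<open>m\<close> loses nothing, and \<open>3 \<le> m\<close> lets
  \<open>c_double'\<close> cover equal indices.\<close>

lemma card_c_layer_ge:
  assumes "3 \<le> m" "m \<le> p" "T m \<noteq> {}"
  shows "min p (t 1 + t m - 1) \<le> card {k\<in>Z. m \<le> c k}"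
proof -
  have "sums (T 1) (T m) \<subseteq> {k\<in>Z. m \<le> c k}"
  proof
    fix k assume "k \<in> sums (T 1) (T m)"
    then obtain x y where xy: "x \<in> T 1" "y \<in> T m" "k = (x + y) mod int p"
      by (auto simp: sums_def)
    have "m \<le> c k"
    proof (cases "x = y")
      case True
      then show ?thesis using xy c_double'[of y] assms by (auto simp: T_def)
    next
      case False
      then show ?thesis using c_ge[of x 1 y m] xy assms by auto
    qed
    then show "k \<in> {k\<in>Z. m \<le> c k}" using xy by auto
  qed
  then have "card (sums (T 1) (T m)) \<le> card {k\<in>Z. m \<le> c k}" by (intro card_mono finite_subset_Z) auto
  moreover have "min p (t 1 + t m - 1) \<le> card (sums (T 1) (T m))"
    using assms T_antimono[of 1 m] by (intro Cauchy_Davenport T_subset) auto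
  ultimately show ?thesis by simp
qed

text \<open>By pigeonhole every index is a sum from \<open>T 1\<close> and \<open>T 4\<close>, and
  either kind of sum, equal or distinct indices, forces \<open>4 \<le> c k\<close>.\<close>

lemma sum_c_ge_if_t1_t4:
  assumes "p < t 1 + t 4"
  shows "4 * p \<le> (\<Sum>k\<in>Z. c k)"
proof -
  have "4 \<le> c k" if "k \<in> Z" for k
  proof -
    obtain x y where xy: "x \<in> T 1" "y \<in> T 4" "(x + y) mod int p = k mod int p"
      using pigeonhole[OF T_subset T_subset assms] by metis
    then have k: "(x + y) mod int p = k" using that by simp
    show ?thesis
    proof (cases "x = y")
      case True
      then show ?thesis using xy k c_double'[of y] by (auto simp: T_def)
    next
      case False
      then show ?thesis using c_ge[of x 1 y 4] xy k p_ge_5 by auto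
    qed
  qed
  then have "(\<Sum>k\<in>Z. 4) \<le> (\<Sum>k\<in>Z. c k)" by (intro sum_mono) auto
  then show ?thesis by simp
qed

text \<open>By pigeonhole every index is a sum from \<open>T 2\<close> and \<open>T 3\<close>. This
  gives \<open>4 \<le> c k\<close> except at the double of a fibre of size 3, where one element may
  be missing. The size of \<open>T 3\<close> decides how these losses are compensated.\<close>

lemma sum_c_ge_if_t2_t3:
  assumes "p < t 2 + t 3"
  shows "4 * p \<le> (\<Sum>k\<in>Z. c k)"
proof -
  \<comment> \<open>lines where \<open>c\<close> falls short of 4; the deficit is made up by \<open>R\<close>, where \<open>c \<ge> 5\<close>\<close>
  define E where "E = {k\<in>Z. c k < 4}"
  define R where "R = distinct_sums (T 3)"
  have RZ: "R \<subseteq> Z" unfolding R_def by (rule distinct_sums_subset)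
  have E: "\<exists>i\<in>Z. a i = 3 \<and> k = (i + i) mod int p \<and> c k = 3" if "k \<in> E" for k
  proof -
    have kE: "k mod int p = k" "c k < 4" using that by (auto simp: E_def)
    obtain x y where xy: "x \<in> T 2" "y \<in> T 3" "(x + y) mod int p = k mod int p"
      using pigeonhole[OF T_subset T_subset assms] by metis
    then have k: "k = (x + y) mod int p" using kE by simp
    have "x = y"
    proof (rule ccontr)
      assume "x \<noteq> y"
      then have "2 + 3 - 1 \<le> c k" unfolding k using xy p_ge_5 by (intro c_ge) auto
      then show False using kE by simp
    qed
    moreover have y: "y \<in> Z" "3 \<le> a y" using xy by (auto simp: T_def)
    ultimately have "a y \<le> c k" using c_double'[of y] k by simp
    then have "a y = 3" "c k = 3" using y kE by linarith+
    then show ?thesis using y(1) k \<open>x = y\<close> by blast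
  qed
  have R: "5 \<le> c k" if k: "k \<in> R" for k
  proof -
    obtain x y where "x \<in> T 3" "y \<in> T 3" "x \<noteq> y" "k = (x + y) mod int p"
      using k unfolding R_def distinct_sums_def by blast
    then show ?thesis using c_ge[of x 3 y 3] p_ge_5 by simp
  qed
  have if_card: ?thesis if "card E \<le> card R"
  proof -
    have "(\<Sum>k\<in>Z. 4 + of_bool (k \<in> R)) \<le> (\<Sum>k\<in>Z. c k + of_bool (k \<in> E))"
    proof (intro sum_mono)
      fix k assume "k \<in> Z"
      then show "4 + of_bool (k \<in> R) \<le> c k + of_bool (k \<in> E)"
        using E[of k] R[of k] by (cases "k \<in> E"; cases "k \<in> R") (auto simp: E_def)
    qed
    moreover have "(\<Sum>k\<in>Z. of_bool (k \<in> R)) = card R" "(\<Sum>k\<in>Z. of_bool (k \<in> E)) = card E"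
      using RZ by (auto simp: E_def Int_absorb1 Int_def intro!: arg_cong[where f = card])
    ultimately show ?thesis using that by (simp add: sum.distrib)
  qed
  have "t 3 \<noteq> 0" using assms t_le[of 2] by linarith
  then consider "t 3 = 1" | "t 3 = 2" | "3 \<le> t 3" by linarith
  then show ?thesis
  proof cases
    case 1
    then obtain x where x: "T 3 = {x}" by (auto simp: card_1_singleton_iff)
    then have xZ: "x \<in> Z" using T_subset[of 3] by simp
    \<comment> \<open>A single large fibre forces the excluded flat profile.\<close>
    have "T 2 = Z" using assms 1 by (intro eq_Z T_subset) auto
    have a2: "a j = 2" if j: "j \<in> Z - {x}" for j
    proof -
      have "j \<in> T 2" "j \<notin> T 3" using j x \<open>T 2 = Z\<close> by auto
      then show ?thesis using j by (auto simp: T_def)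
    qed
    have "(\<Sum>i\<in>Z. a i) = a x + (\<Sum>i\<in>Z - {x}. a i)" using xZ by (simp add: sum.remove)
    also have "(\<Sum>i\<in>Z - {x}. a i) = (\<Sum>i\<in>Z - {x}. 2)" using a2 by (rule sum.cong[OF refl])
    also have "\<dots> = (p - 1) * 2" using xZ by simp
    finally have "a x = 3" using sum_a p_ge_5 by simp
    then show ?thesis using not_flat a2 xZ by blast
  next
    case 2
    then obtain x y where xy: "T 3 = {x, y}" "x \<noteq> y" by (auto simp: card_2_iff)
    then have xyZ: "x \<in> Z" "y \<in> Z" using T_subset[of 3] by auto
    have "{(x + y) mod int p} \<subseteq> R"
      using xy unfolding R_def distinct_sums_def by blast
    then have "card {(x + y) mod int p} \<le> card R" by (rule card_mono[OF finite_subset_Z[OF RZ]])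
    then have cR: "1 \<le> card R" by simp
    \<comment> \<open>The reflection of \<open>v\<close> in \<open>u\<close> adds with
      \<open>v\<close> to \<open>2 * u\<close>. If its fibre had two points, then \<open>c\<close>
      would be at least 4 there, contrary to membership in \<open>E\<close>.\<close>
    have notin: "(2 * u - v) mod int p \<notin> T 2"
      if uv: "u \<in> Z" "v \<in> T 3" "u \<noteq> v" "(u + u) mod int p \<in> E" for u v
    proof
      assume in2: "(2 * u - v) mod int p \<in> T 2"
      have "(2 * u - v) mod int p \<noteq> v"
      proof
        assume eq: "(2 * u - v) mod int p = v"
        have vZ: "v \<in> Z" using uv T_subset by blast
        then have "v mod int p = v" by simp
        then have "(2 * u - v) mod int p = v mod int p" using eq by metis
        then have "int p dvd 2 * (u - v)" by (simp add: mod_eq_dvd_iff algebra_simps)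
        moreover have "\<not> int p dvd 2" using p_ge_5 by (auto dest: zdvd_imp_le)
        ultimately show False using dvd_diff_if_dvd_mult uv vZ by blast
      qed
      then have "4 \<le> c (((2 * u - v) mod int p + v) mod int p)"
        using c_ge[OF in2 uv(2)] p_ge_5 by auto
      then show False using uv by (simp add: mod_simps E_def)
    qed
    have "card E \<le> 1"
    proof (rule ccontr)
      assume card_E: "\<not> card E \<le> 1"
      have E_sub: "E \<subseteq> {(x + x) mod int p, (y + y) mod int p}"
      proof
        fix k assume "k \<in> E"
        then obtain i where i: "i \<in> Z" "a i = 3" "k = (i + i) mod int p" using E by blast
        then have "i \<in> T 3" by (simp add: T_def)
        then show "k \<in> {(x + x) mod int p, (y + y) mod int p}" using i xy by auto
      qed
      have "\<not> E \<subseteq> {k}" for k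
        using card_E card_mono[of "{k}" E] by auto
      then have in_E: "(x + x) mod int p \<in> E" "(y + y) mod int p \<in> E"
        using E_sub by blast+
      \<comment> \<open>Two deficient indices would make both reflections miss \<open>T 2\<close>.
        They are distinct as \<open>p\<close> does not divide 3, so \<open>t 2 \<le> p - 2\<close>,
        against the assumption.\<close>
      let ?u = "(2 * x - y) mod int p" and ?v = "(2 * y - x) mod int p"
      have "?u \<noteq> ?v"
      proof
        assume "?u = ?v"
        then have "int p dvd 3 * (x - y)" by (simp add: mod_eq_dvd_iff algebra_simps)
        moreover have "\<not> int p dvd 3" using p_ge_5 by (auto dest: zdvd_imp_le)
        ultimately show False using dvd_diff_if_dvd_mult xyZ xy by blast
      qed
      moreover have "?u \<notin> T 2" "?v \<notin> T 2" using notin xy xyZ in_E by auto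
      ultimately have "card (insert ?u (insert ?v (T 2))) = t 2 + 2" by simp
      moreover have "card (insert ?u (insert ?v (T 2))) \<le> p"
        using T_subset[of 2] by (intro card_le_p) auto
      ultimately show False using assms 2 by simp
    qed
    then show ?thesis by (intro if_card) (use cR in linarith)
  next
    case 3
    have "E \<subseteq> (\<lambda>i. (i + i) mod int p) ` T 3" using E by (force simp: T_def)
    then have "card E \<le> t 3" by (rule surj_card_le[rotated]) simp
    also have "\<dots> \<le> card R" unfolding R_def by (rule card_le_card_distinct_sums[OF T_subset 3])
    finally show ?thesis by (rule if_card)
  qed
qed

text \<open>Any two of the fibres have at least \<open>p + 1\<close> points together, so the three
  mixed sums fill three lines. The doubles of \<open>y\<close> and \<open>z\<close> jointly supply a
  fourth \<open>p\<close>; the assumptions \<open>double\<close> keep them off those three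
  lines.\<close>

lemma sum_c_ge_triple_aux:
  assumes xyz: "x \<in> Z" "y \<in> Z" "z \<in> Z" "x \<noteq> y" "x \<noteq> z" "y \<noteq> z"
    and sum: "a x + a y + a z = 2 * p + 1"
    and double: "\<not> int p dvd 2 * y - (x + z)" "\<not> int p dvd 2 * z - (x + y)"
  shows "4 * p \<le> (\<Sum>k\<in>Z. c k)"
proof -
  have full: "a x + a y \<ge> p + 1" "a x + a z \<ge> p + 1" "a y + a z \<ge> p + 1"
    using sum a_le[OF xyz(1)] a_le[OF xyz(2)] a_le[OF xyz(3)] by linarith+
  then have pos: "1 \<le> a x" "1 \<le> a y" "1 \<le> a z"
    using a_le[OF xyz(1)] a_le[OF xyz(2)] a_le[OF xyz(3)] by linarith+
  have c3: "p \<le> c ((x + y) mod int p)" "p \<le> c ((x + z) mod int p)" "p \<le> c ((y + z) mod int p)"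
    using c_add[of x y] c_add[of x z] c_add[of y z] xyz pos full by auto
  \<comment> \<open>Only a fibre with fewer than 3 points can lose an element on doubling, so at
    most one is lost from \<open>a y + a z \<ge> p + 1\<close>.\<close>
  have "3 \<le> a y \<or> 3 \<le> a z" using full p_ge_5 by linarith
  then have c2: "p \<le> c ((y + y) mod int p) + c ((z + z) mod int p)"
    using c_double[OF xyz(2)] c_double[OF xyz(3)] c_double'[OF xyz(2)] c_double'[OF xyz(3)] full
    by linarith
  have not_dvd: "\<not> int p dvd u - v" if "u \<in> Z" "v \<in> Z" "u \<noteq> v" for u v
    using that eq_if_dvd_diff by blast
  have "\<not> int p dvd 2 * (y - z)"
  proof -
    have "\<not> int p dvd 2" using p_ge_5 by (auto dest: zdvd_imp_le)
    then show ?thesis using dvd_diff_if_dvd_mult xyz by blast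
  qed
  then have double': "\<not> int p dvd 2 * (y - z)" .
  have neq: "u mod int p \<noteq> v mod int p" if "\<not> int p dvd w" "u - v = w" for u v w
    using that mod_eq_dvd_iff by metis
  have five: "4 * p \<le> (\<Sum>k\<in>Z. c k)"
    if "distinct [k1, k2, k3, k4, k5]" "{k1, k2, k3, k4, k5} \<subseteq> Z"
      "p \<le> c k1" "p \<le> c k2" "p \<le> c k3" "p \<le> c k4 + c k5" for k1 k2 k3 k4 k5
  proof -
    have "4 * p \<le> (\<Sum>k\<in>{k1, k2, k3, k4, k5}. c k)" using that by simp
    also have "\<dots> \<le> (\<Sum>k\<in>Z. c k)" using that by (intro sum_mono2) auto
    finally show ?thesis .
  qed
  show ?thesis
  proof (rule five[OF _ _ c3 c2])
    have "(x + y) mod int p \<noteq> (x + z) mod int p" by (rule neq[OF not_dvd[OF xyz(2,3,6)]]) simp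
    moreover have "(x + y) mod int p \<noteq> (y + z) mod int p" by (rule neq[OF not_dvd[OF xyz(1,3,5)]]) simp
    moreover have "(x + z) mod int p \<noteq> (y + z) mod int p" by (rule neq[OF not_dvd[OF xyz(1,2,4)]]) simp
    moreover have "(x + y) mod int p \<noteq> (y + y) mod int p" by (rule neq[OF not_dvd[OF xyz(1,2,4)]]) simp
    moreover have "(y + y) mod int p \<noteq> (x + z) mod int p" by (rule neq[OF double(1)]) simp
    moreover have "(y + y) mod int p \<noteq> (y + z) mod int p" by (rule neq[OF not_dvd[OF xyz(2,3,6)]]) simp
    moreover have "(z + z) mod int p \<noteq> (x + y) mod int p" by (rule neq[OF double(2)]) simp
    moreover have "(x + z) mod int p \<noteq> (z + z) mod int p" by (rule neq[OF not_dvd[OF xyz(1,3,5)]]) simp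
    moreover have "(y + z) mod int p \<noteq> (z + z) mod int p" by (rule neq[OF not_dvd[OF xyz(2,3,6)]]) simp
    moreover have "(y + y) mod int p \<noteq> (z + z) mod int p" by (rule neq[OF double']) simp
    ultimately show "distinct [(x + y) mod int p, (x + z) mod int p, (y + z) mod int p,
        (y + y) mod int p, (z + z) mod int p]" by (metis distinct_length_2_or_more distinct_singleton)
  qed auto
qed

text \<open>As \<open>p\<close> does not divide 3, at most one of the three indices is the midpoint
  of the other two; that one, if any, takes the role of \<open>x\<close> in the preceding
  lemma.\<close>

lemma sum_c_ge_if_t1_eq_3:
  assumes "t 1 = 3"
  shows "4 * p \<le> (\<Sum>k\<in>Z. c k)"
proof -
  obtain x y z where T1: "T 1 = {x, y, z}" and ne: "x \<noteq> y" "x \<noteq> z" "y \<noteq> z"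
    using assms by (auto simp: card_3_iff)
  have Z: "x \<in> Z" "y \<in> Z" "z \<in> Z" using T1 T_subset[of 1] by auto
  have sum: "a x + a y + a z = 2 * p + 1" using sum_T1 T1 ne by simp
  have three: "\<not> int p dvd 3" using p_ge_5 by (auto dest: zdvd_imp_le)
  have one: "\<not> int p dvd 2 * v - (u + w)"
    if "int p dvd 2 * u - (v + w)" "u \<in> Z" "v \<in> Z" "u \<noteq> v" for u v w
  proof
    assume "int p dvd 2 * v - (u + w)"
    then have "int p dvd (2 * u - (v + w)) - (2 * v - (u + w))" by (rule dvd_diff[OF that(1)])
    then have "int p dvd 3 * (u - v)" by (simp add: algebra_simps)
    then show False using three dvd_diff_if_dvd_mult that by blast
  qed
  show ?thesis
  proof (cases "int p dvd 2 * x - (y + z)")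
    case True
    then show ?thesis
      using sum_c_ge_triple_aux[of x y z] one[of x y z] one[of x z y] Z ne sum
      by (simp add: add.commute)
  next
    case False
    show ?thesis
    proof (cases "int p dvd 2 * y - (x + z)")
      case True
      then show ?thesis
        using sum_c_ge_triple_aux[of y x z] one[of y x z] one[of y z x] Z ne sum
        by (simp add: add.commute add.left_commute)
    next
      case False
      then show ?thesis
        using sum_c_ge_triple_aux[of z x y] \<open>\<not> int p dvd 2 * x - (y + z)\<close> Z ne sum
        by (simp add: add.commute add.left_commute)
    qed
  qed
qed

text \<open>The layers \<open>{k. m \<le> c k}\<close> with \<open>m \<le> M = Max a\<close> are bounded below by Cauchy--Davenport; what
  exceeds \<open>M\<close> is collected in \<open>G\<close> from the sums involving a largest fibre \<open>i0\<close>.\<close>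

lemma sum_c_ge_if_4_le_t1:
  assumes t1: "4 \<le> t 1" and t14: "t 1 + t 4 \<le> p" and t23: "t 2 + t 3 \<le> p"
  shows "4 * p \<le> (\<Sum>k\<in>Z. c k)"
proof -
  define M where "M = Max (a ` Z)"
  have a_le_M: "a i \<le> M" if "i \<in> Z" for i
    using that by (simp add: M_def)
  have "M \<in> a ` Z" unfolding M_def using p_ge_5 by (intro Max_in) auto
  then obtain i0 where i0: "i0 \<in> Z" "a i0 = M" by auto
  \<comment> \<open>Otherwise the first four layers would exhaust \<open>2 * p + 1\<close>, while
    \<open>t14\<close> and \<open>t23\<close> bound them by \<open>2 * p\<close>.\<close>
  have "5 \<le> M"
  proof (rule ccontr)
    assume "\<not> 5 \<le> M"
    then have "a i \<le> 4" if "i \<in> Z" for i using a_le_M[OF that] by linarith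
    then have "(\<Sum>s=1..4. t s) = 2 * p + 1" by (rule sum_t)
    moreover have "{1..4} = {1, 2, 3, 4::nat}" by auto
    ultimately show False using t14 t23 by simp
  qed
  have "M \<le> p" using i0 a_le by auto
  define n where "n = t 1"
  define N where "N m = card {k\<in>Z. m \<le> c k}" for m
  define J where "J = T 1 - {i0}"
  define G where "G = (\<Sum>j\<in>J. min (p - M) (a j - 1))"
  have i0_T: "i0 \<in> T m" if "m \<le> M" for m using i0 that by (simp add: T_def)
  have card_J: "card J + 1 = n"
    using i0_T[of 1] \<open>5 \<le> M\<close> t1 by (simp add: J_def n_def)
  have fin_J: "finite J" by (simp add: J_def)
  have J: "j \<in> Z" "1 \<le> a j" "a j \<le> M" "j \<noteq> i0" if "j \<in> J" for j
    using that a_le_M by (auto simp: J_def T_def)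

  \<comment> \<open>The bound \<open>min p (a j + M - 1)\<close> equals
    \<open>M + min (p - M) (a j - 1)\<close>, and the indices \<open>j + i0\<close> are
    distinct.\<close>
  have "G \<le> (\<Sum>j\<in>J. c ((j + i0) mod int p) - M)"
    unfolding G_def
  proof (rule sum_mono)
    fix j assume j: "j \<in> J"
    then have "min p (a j + M - 1) \<le> c ((j + i0) mod int p)"
      using c_add[of j i0] i0 J[OF j] \<open>5 \<le> M\<close> by auto
    then show "min (p - M) (a j - 1) \<le> c ((j + i0) mod int p) - M"
      using J(2)[OF j] \<open>M \<le> p\<close> by linarith
  qed
  also have "\<dots> = (\<Sum>k\<in>(\<lambda>j. (j + i0) mod int p) ` J. c k - M)"
    using J by (subst sum.reindex) (auto intro!: inj_on_add simp: o_def)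
  also have "\<dots> \<le> (\<Sum>k\<in>Z. c k - M)" by (intro sum_mono2) auto
  finally have G: "G \<le> (\<Sum>k\<in>Z. c k - M)" .

  have N: "min p (n + t m - 1) \<le> N m" if "3 \<le> m" "m \<le> M" for m
    unfolding n_def N_def using that i0_T \<open>M \<le> p\<close> by (intro card_c_layer_ge) auto
  have N_antimono: "N m \<le> N l" if "l \<le> m" for l m
    unfolding N_def using that by (intro card_mono finite_subset_Z) auto
  have split: "(\<Sum>m=1..M. f m) = f 1 + f 2 + f 3 + (\<Sum>m=4..M. f m)" for f :: "nat \<Rightarrow> nat"
    using \<open>5 \<le> M\<close> by (simp add: sum.atLeast_Suc_atMost numeral_eq_Suc)
  have "(\<Sum>m=1..M. N m) = (\<Sum>k\<in>Z. min (c k) M)"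
    unfolding N_def by (simp add: sum_min_eq_sum_card_layers)
  also have "\<dots> + (\<Sum>k\<in>Z. c k - M) = (\<Sum>k\<in>Z. c k)"
    unfolding sum.distrib[symmetric] by (rule sum.cong) auto
  finally have ge1: "N 1 + N 2 + N 3 + (\<Sum>m=4..M. N m) + G \<le> (\<Sum>k\<in>Z. c k)"
    using G split[of N] by linarith
  \<comment> \<open>For \<open>4 \<le> m\<close> the assumption \<open>t14\<close> keeps the
    Cauchy--Davenport bound below the cap \<open>p\<close>.\<close>
  have "(\<Sum>m=4..M. n - 1 + t m) \<le> (\<Sum>m=4..M. N m)"
  proof (rule sum_mono)
    fix m assume m: "m \<in> {4..M}"
    then have "t m \<le> t 4" by (intro t_antimono) auto
    then show "n - 1 + t m \<le> N m" using N[of m] m t14 t1 unfolding n_def by (auto simp: min_def split: if_splits)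
  qed
  then have ge2: "(M - 3) * (n - 1) + (\<Sum>m=4..M. t m) \<le> (\<Sum>m=4..M. N m)"
    using \<open>5 \<le> M\<close> by (simp add: sum.distrib)
  have sum_t4: "n + t 2 + t 3 + (\<Sum>m=4..M. t m) = 2 * p + 1"
    using sum_t[OF a_le_M] split[of t] by (simp add: n_def)
  \<comment> \<open>The layer bound starts at 3; the first two layers are at least as large as the
    third.\<close>
  have N3: "min p (n + t 3 - 1) \<le> N 3" "N 3 \<le> N 2" "N 2 \<le> N 1"
    using N[of 3] N_antimono \<open>5 \<le> M\<close> by auto
  have t3: "1 \<le> t 3" "t 2 \<le> n"
    using i0_T[of 3] \<open>5 \<le> M\<close> t_antimono[of 1 2] by (auto simp: n_def Suc_le_eq card_gt_0_iff)

  obtain u v where M: "M = 5 + u" and n: "n = 4 + v"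
    using \<open>5 \<le> M\<close> t1 le_Suc_ex unfolding n_def by metis
  have prod: "(M - 3) * (n - 1) = u * v + 3 * u + 2 * v + 6" by (simp add: M n algebra_simps)

  show ?thesis
  proof (cases "p \<le> n + t 3 - 1")
    case True
    then show ?thesis using ge1 ge2 sum_t4 N3 prod t23 n by linarith
  next
    case False
    then have N3': "n + t 3 - 1 \<le> N 3" using N3 by linarith
    \<comment> \<open>With \<open>t 2 \<le> n\<close> it remains to show
      \<open>2 * p + 2 \<le> G + n + 2 * t 3 + (M - 3) * (n - 1)\<close>.\<close>
    have key: "3 * (n + t 3 - 1) + (u * v + 3 * u + 2 * v + 6) + (2 * p + 1) + G
        \<le> (\<Sum>k\<in>Z. c k) + n + t 2 + t 3"
      using ge1 ge2 sum_t4 N3 N3' prod by linarith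
    have sum_J: "(\<Sum>j\<in>J. a j) + M = 2 * p + 1"
      using sum_T1 i0_T[of 1] i0 \<open>5 \<le> M\<close> sum.remove[of "T 1" i0 a] by (simp add: J_def)
    have sum_sub: "(\<Sum>j\<in>K. a j - 1) + card K = (\<Sum>j\<in>K. a j)" if "K \<subseteq> J" for K
    proof -
      have "(\<Sum>j\<in>K. a j - 1) + card K = (\<Sum>j\<in>K. a j - 1 + 1)" by (simp only: sum.distrib) simp
      also have "\<dots> = (\<Sum>j\<in>K. a j)" using that J(2) by (intro sum.cong) force+
      finally show ?thesis .
    qed
    \<comment> \<open>the fibres whose sum with the fibre over \<open>i0\<close> fills a whole line\<close>
    define B where "B = {j\<in>J. p - M \<le> a j - 1}"
    have B: "B \<subseteq> J" "finite B" using fin_J by (auto simp: B_def)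
    have sum_unsat: "(\<Sum>j\<in>K. min (p - M) (a j - 1)) = (\<Sum>j\<in>K. a j - 1)" if "K \<subseteq> J - B" for K
      using that by (intro sum.cong) (auto simp: B_def)
    consider "card B = 0" | "card B = 1" | "2 \<le> card B" by linarith
    then show ?thesis
    proof cases
      case 1
      then have "B = {}" using B by simp
      then have "G = (\<Sum>j\<in>J. a j - 1)" unfolding G_def by (intro sum_unsat) auto
      then have "G + card J + M = 2 * p + 1" using sum_sub[of J] sum_J by simp
      then show ?thesis using key card_J M n t3 by linarith
    next
      case 2
      then obtain b where b: "B = {b}" by (auto simp: card_1_singleton_iff)
      then have bJ: "b \<in> J" using B by auto
      have "G = (p - M) + (\<Sum>j\<in>J - {b}. a j - 1)"
        unfolding G_def using bJ fin_J b sum_unsat[of "J - {b}"]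
        by (subst sum.remove[of J b]) (auto simp: B_def)
      moreover have "(\<Sum>j\<in>J - {b}. a j - 1) + card (J - {b}) = (\<Sum>j\<in>J - {b}. a j)"
        by (rule sum_sub) auto
      moreover have "card (J - {b}) + 2 = n" using card_J bJ fin_J n by simp
      moreover have "(\<Sum>j\<in>J. a j) = a b + (\<Sum>j\<in>J - {b}. a j)" using bJ fin_J by (simp add: sum.remove)
      \<comment> \<open>With \<open>5 \<le> M\<close> this gives \<open>6 \<le> p\<close>, exactly
        what the final estimate requires in its tightest case.\<close>
      moreover have "M < p"
      proof (rule ccontr)
        assume "\<not> M < p"
        then have "J = B" by (auto simp: B_def)
        then show False using 2 card_J n by simp
      qed
      ultimately show ?thesis using key sum_J J(3)[OF bJ] M n t3 by linarith
    next
      case 3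
      have "card B * (p - M) = (\<Sum>j\<in>B. min (p - M) (a j - 1))" by (simp add: B_def)
      also have "\<dots> \<le> G" unfolding G_def using B fin_J by (intro sum_mono2) auto
      finally have "2 * (p - M) \<le> G" using 3 by (meson le_trans mult_le_mono1)
      then show ?thesis using key M n t3 \<open>M \<le> p\<close> by linarith
    qed
  qed
qed

theorem sum_c_ge: "4 * p \<le> (\<Sum>k\<in>Z. c k)"
proof -
  have "(\<Sum>i\<in>T 1. a i) \<le> (\<Sum>i\<in>T 1. p)" by (intro sum_mono a_le) (auto simp: T_def)
  then have "2 * p + 1 \<le> t 1 * p" using sum_T1 by simp
  then have "\<not> t 1 \<le> 2" using mult_le_mono1[of "t 1" 2 p] by linarith
  then consider "p < t 1 + t 4" | "p < t 2 + t 3" | "t 1 = 3" |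
      "4 \<le> t 1" "t 1 + t 4 \<le> p" "t 2 + t 3 \<le> p" by linarith
  then show ?thesis
    using sum_c_ge_if_t1_t4 sum_c_ge_if_t2_t3 sum_c_ge_if_t1_eq_3 sum_c_ge_if_4_le_t1 by cases
qed

end

section \<open>Choosing a direction\<close>

context prime_ge_5
begin

definition flat :: "'a set \<Rightarrow> ('a \<Rightarrow> int) \<Rightarrow> bool" where
  "flat A f \<longleftrightarrow> (\<exists>i\<in>Z. card {u\<in>A. f u = i} = 3 \<and> (\<forall>j\<in>Z - {i}. card {u\<in>A. f u = j} = 2))"

lemma carrier_Zp2: "carrier (Zp2 p) = Z \<times> Z"
  using p_ge_5 by (simp add: DirProd_def carrier_integer_mod_group)

lemma mult_Zp2: "u \<otimes>\<^bsub>Zp2 p\<^esub> v = ((fst u + fst v) mod int p, (snd u + snd v) mod int p)"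
  by (simp add: DirProd_def mult_integer_mod_group case_prod_beta)

lemma card_eq_sum_fibres:
  assumes "finite A" "f ` A \<subseteq> Z"
  shows "(\<Sum>i\<in>Z. card {u\<in>A. f u = i}) = card A"
  using sum.group[of A Z f "\<lambda>_. 1 :: nat"] assms by simp

lemma card_distinct_sums_ge_pred:
  assumes "B \<subseteq> Z"
  shows "card B - 1 \<le> card (distinct_sums B)"
proof (cases "B = {}")
  case False
  then obtain x where x: "x \<in> B" by auto
  have "card ((\<lambda>y. (y + x) mod int p) ` (B - {x})) = card B - 1"
    using x assms by (subst card_image[OF inj_on_add]) auto
  moreover have "(\<lambda>y. (y + x) mod int p) ` (B - {x}) \<subseteq> distinct_sums B"
    using x by (auto simp: distinct_sums_def)
  ultimately show ?thesis
    by (metis card_mono distinct_sums_subset finite_subset_Z)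
qed simp

text \<open>\<open>f\<close> and \<open>g\<close> serve as linear coordinates: \<open>f\<close>
  tells which line of the direction contains a point, and \<open>g\<close> gives its position on
  that line.\<close>

lemma restricted_sumset_ge_if_not_flat:
  fixes f g :: "int \<times> int \<Rightarrow> int"
  assumes A: "A \<subseteq> Z \<times> Z" "card A = 2 * p + 1" "\<not> flat A f"
    and f: "\<And>u. u \<in> Z \<times> Z \<Longrightarrow> f u \<in> Z"
      "\<And>u v. f (u \<otimes>\<^bsub>Zp2 p\<^esub> v) = (f u + f v) mod int p"
    and g: "\<And>u. u \<in> Z \<times> Z \<Longrightarrow> g u \<in> Z"
      "\<And>u v. g (u \<otimes>\<^bsub>Zp2 p\<^esub> v) = (g u + g v) mod int p"
    and inj: "\<And>u v. \<lbrakk>u \<in> Z \<times> Z; v \<in> Z \<times> Z; f u = f v; g u = g v\<rbrakk> \<Longrightarrow> u = v"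
  shows "4 * p \<le> card (restricted_sumset (Zp2 p) A)"
proof -
  define C where "C = restricted_sumset (Zp2 p) A"
  have C: "C \<subseteq> Z \<times> Z" by (auto simp: C_def restricted_sumset_def mult_Zp2)
  have fin: "finite X" if "X \<subseteq> Z \<times> Z" for X :: "(int \<times> int) set"
    using that by (rule finite_subset) auto
  define fibre where "fibre X i = g ` {u\<in>X. f u = i}" for X i
  have card_fibre: "card (fibre X i) = card {u\<in>X. f u = i}" if "X \<subseteq> Z \<times> Z" for X i
    unfolding fibre_def using that by (intro card_image inj_onI inj) auto
  have fibre_subset: "fibre X i \<subseteq> Z" if "X \<subseteq> Z \<times> Z" for X i
    using that g(1) unfolding fibre_def by blast
  have fibre_C: "card K \<le> card (fibre C k)" if "K \<subseteq> fibre C k" for K k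
    using that by (intro card_mono finite_subset_Z fibre_subset C)
  have sum_fibres: "(\<Sum>i\<in>Z. card (fibre X i)) = card X" if "X \<subseteq> Z \<times> Z" for X
  proof -
    have "f ` X \<subseteq> Z" using f(1) that by blast
    then show ?thesis using card_eq_sum_fibres[OF fin[OF that], of f] that by (simp add: card_fibre)
  qed
  have double: "card (distinct_sums (fibre A i)) \<le> card (fibre C ((i + i) mod int p))" for i
  proof (rule fibre_C, rule subsetI)
    fix k assume "k \<in> distinct_sums (fibre A i)"
    then obtain u v where uv: "u \<in> A" "v \<in> A" "f u = i" "f v = i" "u \<noteq> v" "k = (g u + g v) mod int p"
      unfolding distinct_sums_def fibre_def by blast
    then have "u \<otimes>\<^bsub>Zp2 p\<^esub> v \<in> C" unfolding C_def restricted_sumset_def by blast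
    then show "k \<in> fibre C ((i + i) mod int p)"
      unfolding fibre_def using uv f(2) g(2) by (intro image_eqI[of _ _ "u \<otimes>\<^bsub>Zp2 p\<^esub> v"]) auto
  qed
  interpret profile p "\<lambda>i. card (fibre A i)" "\<lambda>k. card (fibre C k)"
  proof unfold_locales
    show "(\<Sum>i\<in>Z. card (fibre A i)) = 2 * p + 1" using sum_fibres A by simp
    show "card (fibre A i) \<le> p" for i by (intro card_le_p fibre_subset A)
    show "min p (card (fibre A i) + card (fibre A j) - 1) \<le> card (fibre C ((i + j) mod int p))"
      if "i \<noteq> j" "1 \<le> card (fibre A i)" "1 \<le> card (fibre A j)" for i j
    proof -
      have "sums (fibre A i) (fibre A j) \<subseteq> fibre C ((i + j) mod int p)"
      proof
        fix k assume "k \<in> sums (fibre A i) (fibre A j)"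
        then obtain u v where uv: "u \<in> A" "v \<in> A" "f u = i" "f v = j" "k = (g u + g v) mod int p"
          unfolding sums_def fibre_def by blast
        \<comment> \<open>Points on different lines are distinct, so the restriction is vacuous and
          the ordinary Cauchy--Davenport bound applies.\<close>
        then have "u \<noteq> v" using that by auto
        then have "u \<otimes>\<^bsub>Zp2 p\<^esub> v \<in> C" using uv unfolding C_def restricted_sumset_def by blast
        then show "k \<in> fibre C ((i + j) mod int p)"
          unfolding fibre_def using uv f(2) g(2) by (intro image_eqI[of _ _ "u \<otimes>\<^bsub>Zp2 p\<^esub> v"]) auto
      qed
      then have "card (sums (fibre A i) (fibre A j)) \<le> card (fibre C ((i + j) mod int p))"
        by (rule fibre_C)
      moreover have "fibre A i \<noteq> {}" "fibre A j \<noteq> {}" using that by auto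
      ultimately show ?thesis
        using Cauchy_Davenport[OF fibre_subset[OF A(1)] fibre_subset[OF A(1)]] le_trans by blast
    qed
    show "card (fibre A i) - 1 \<le> card (fibre C ((i + i) mod int p))" for i
      using card_distinct_sums_ge_pred[OF fibre_subset[OF A(1)]] double le_trans by blast
    show "card (fibre A i) \<le> card (fibre C ((i + i) mod int p))" if "3 \<le> card (fibre A i)" for i
      using card_le_card_distinct_sums[OF fibre_subset[OF A(1)] that] double le_trans by blast
    show "\<not> (\<exists>i\<in>Z. card (fibre A i) = 3 \<and> (\<forall>j\<in>Z - {i}. card (fibre A j) = 2))"
      using A(3) unfolding flat_def card_fibre[OF A(1)] .
  qed
  have "4 * p \<le> (\<Sum>k\<in>Z. card (fibre C k))" by (rule sum_c_ge)
  then show ?thesis using sum_fibres[OF C] by (simp add: C_def)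
qed

text \<open>Ordered pairs, diagonal included: \<open>9 + 4 * (p - 1)\<close>.\<close>

lemma card_collisions_if_flat:
  assumes "finite A" "f ` A \<subseteq> Z" "flat A f"
  shows "card {(u, v). u \<in> A \<and> v \<in> A \<and> f u = f v} = 4 * p + 5"
proof -
  obtain i where i: "i \<in> Z" "card {u\<in>A. f u = i} = 3"
      "\<And>j. j \<in> Z - {i} \<Longrightarrow> card {u\<in>A. f u = j} = 2"
    using assms(3) unfolding flat_def by blast
  have "{(u, v). u \<in> A \<and> v \<in> A \<and> f u = f v} = (\<Union>j\<in>Z. {u\<in>A. f u = j} \<times> {u\<in>A. f u = j})"
    using assms(2) by auto
  also have "card \<dots> = (\<Sum>j\<in>Z. card {u\<in>A. f u = j} ^ 2)"
    using assms(1) by (subst card_UN_disjoint) (auto simp: card_cartesian_product power2_eq_square)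
  also have "\<dots> = card {u\<in>A. f u = i} ^ 2 + (\<Sum>j\<in>Z - {i}. card {u\<in>A. f u = j} ^ 2)"
    using i(1) by (simp add: sum.remove)
  also have "(\<Sum>j\<in>Z - {i}. card {u\<in>A. f u = j} ^ 2) = (\<Sum>j\<in>Z - {i}. 4)"
    using i(3) by (intro sum.cong) auto
  finally show ?thesis using i p_ge_5 by simp
qed

text \<open>Otherwise all \<open>p + 1\<close> directions are flat. Count triples
  \<open>(d, u, v)\<close> with \<open>h d u = h d v\<close>: flatness gives exactly
  \<open>p * (4 * p + 5)\<close>, while each diagonal pair contributes \<open>p\<close> and each
  pair off a common vertical line at least 1. This leads to
  \<open>2 * (p * p) \<le> 4 * p + 4\<close>, which is false for \<open>5 \<le> p\<close>.\<close>

lemma card_restricted_sumset_ge: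
  assumes A: "A \<subseteq> Z \<times> Z" "card A = 2 * p + 1"
  shows "4 * p \<le> card (restricted_sumset (Zp2 p) A)"
proof (rule ccontr)
  assume less: "\<not> 4 * p \<le> card (restricted_sumset (Zp2 p) A)"
  define h where "h d u = (snd u - d * fst u) mod int p" for d :: int and u :: "int \<times> int"
  have fin: "finite A" using A(2) p_ge_5 card.infinite by fastforce
  have "flat A fst"
  proof (rule ccontr)
    assume "\<not> flat A fst"
    then have "4 * p \<le> card (restricted_sumset (Zp2 p) A)"
      by (rule restricted_sumset_ge_if_not_flat[OF A, of fst snd]) (auto simp: mult_Zp2)
    then show False using less by simp
  qed
  then have coll_fst: "card {(u, v). u \<in> A \<and> v \<in> A \<and> fst u = fst v} = 4 * p + 5"
    using fin A by (intro card_collisions_if_flat) auto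
  have flat_h: "flat A (h d)" for d
  proof (rule ccontr)
    assume "\<not> flat A (h d)"
    then have "4 * p \<le> card (restricted_sumset (Zp2 p) A)"
    proof (rule restricted_sumset_ge_if_not_flat[OF A, of "h d" fst])
      fix u v :: "int \<times> int"
      have "h d (u \<otimes>\<^bsub>Zp2 p\<^esub> v) = (snd u + snd v - d * (fst u + fst v)) mod int p"
        unfolding h_def mult_Zp2 fst_conv snd_conv
        by (metis mod_diff_left_eq mod_diff_right_eq mod_mult_right_eq)
      also have "snd u + snd v - d * (fst u + fst v) = (snd u - d * fst u) + (snd v - d * fst v)"
        by (simp add: algebra_simps)
      finally show "h d (u \<otimes>\<^bsub>Zp2 p\<^esub> v) = (h d u + h d v) mod int p"
        by (simp add: h_def mod_add_eq)
      assume uv: "u \<in> Z \<times> Z" "v \<in> Z \<times> Z" "h d u = h d v" "fst u = fst v"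
      have "int p dvd (snd u - d * fst u) - (snd v - d * fst v)"
        using uv(3) unfolding h_def mod_eq_dvd_iff .
      then have "int p dvd snd u - snd v" using uv(4) by simp
      then have "snd u = snd v" using uv by (intro eq_if_dvd_diff) auto
      then show "u = v" using uv(4) by (rule prod_eqI[rotated])
    qed (auto simp: h_def mult_Zp2)
    then show False using less by simp
  qed
  have coll_h: "card {(u, v). u \<in> A \<and> v \<in> A \<and> h d u = h d v} = 4 * p + 5" for d
    using fin by (intro card_collisions_if_flat flat_h) (auto simp: h_def)

  \<comment> \<open>the directions \<open>d\<close> are all but the vertical one\<close>
  have dirs: "p * of_bool (u = v) + of_bool (fst u \<noteq> fst v) \<le> card {d\<in>Z. h d u = h d v}"
    if uv: "u \<in> A" "v \<in> A" for u v
  proof -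
    consider "u = v" | "u \<noteq> v" "fst u = fst v" | "fst u \<noteq> fst v" by blast
    then show ?thesis
    proof cases
      case 1
      then have "{d\<in>Z. h d u = h d v} = Z" by auto
      then show ?thesis using 1 by simp
    next
      case 3
      have "\<not> int p dvd fst u - fst v"
        using 3 uv A eq_if_dvd_diff[of "fst u" "fst v"] by fastforce
      then obtain d where d: "d \<in> Z" "(d * (fst u - fst v)) mod int p = (snd u - snd v) mod int p"
        using ex_mult_cong by metis
      then have "int p dvd (snd u - snd v) - d * (fst u - fst v)" by (metis mod_eq_dvd_iff)
      also have "\<dots> = (snd u - d * fst u) - (snd v - d * fst v)" by (simp add: algebra_simps)
      finally have "h d u = h d v" unfolding h_def mod_eq_dvd_iff .
      then have "card {d} \<le> card {d\<in>Z. h d u = h d v}"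
        using d by (intro card_mono finite_subset_Z) auto
      then show ?thesis using 3 by auto
    qed auto
  qed
  have "p * (2 * p + 1) + ((2 * p + 1) * (2 * p + 1) - (4 * p + 5))
    = (\<Sum>(u, v)\<in>A \<times> A. p * of_bool (u = v) + of_bool (fst u \<noteq> fst v))"
  proof -
    have "(\<Sum>(u, v)\<in>A \<times> A. p * of_bool (u = v)) = p * card A"
      using fin by (simp add: sum.cartesian_product[symmetric] sum_distrib_left[symmetric] of_bool_def sum.If_cases)
    moreover have "(\<Sum>(u, v)\<in>A \<times> A. of_bool (fst u \<noteq> fst v))
      = card (A \<times> A - {(u, v). u \<in> A \<and> v \<in> A \<and> fst u = fst v})"
      using fin by (auto simp: case_prod_beta Int_def intro!: arg_cong[where f = card])
    moreover have "\<dots> = card A * card A - (4 * p + 5)"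
      using fin coll_fst by (subst card_Diff_subset) (auto simp: card_cartesian_product intro: finite_subset[of _ "A \<times> A"])
    ultimately show ?thesis using A(2) by (simp add: case_prod_beta sum.distrib)
  qed
  also have "\<dots> \<le> (\<Sum>(u, v)\<in>A \<times> A. card {d\<in>Z. h d u = h d v})"
    using dirs by (intro sum_mono) auto
  also have "\<dots> = (\<Sum>(u, v)\<in>A \<times> A. \<Sum>d\<in>Z. of_bool (h d u = h d v))"
    by (intro sum.cong) (auto simp: Int_def)
  also have "\<dots> = (\<Sum>d\<in>Z. \<Sum>(u, v)\<in>A \<times> A. of_bool (h d u = h d v))"
    by (subst sum.swap) (simp add: case_prod_beta)
  also have "\<dots> = (\<Sum>d\<in>Z. card {(u, v). u \<in> A \<and> v \<in> A \<and> h d u = h d v})"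
    using fin by (intro sum.cong) (auto simp: case_prod_beta Int_def intro!: arg_cong[where f = card])
  also have "\<dots> = p * (4 * p + 5)" by (simp add: coll_h)
  finally have "p * (2 * p + 1) + ((2 * p + 1) * (2 * p + 1) - (4 * p + 5)) \<le> p * (4 * p + 5)" .
  then have "2 * (p * p) \<le> 4 * p + 4" by (simp add: algebra_simps)
  moreover have "5 * p \<le> p * p" using p_ge_5 by simp
  ultimately show False using p_ge_5 by linarith
qed

section \<open>The extremal example\<close>

lemma ex_restricted_sumset_le:
  obtains A where "A \<subseteq> Z \<times> Z" "card A = 2 * p + 1" "card (restricted_sumset (Zp2 p) A) \<le> 4 * p"
proof
  \<comment> \<open>Second coordinate 4 could arise only by doubling the extra point, which the
    restricted sumset forbids; so the sums lie on four lines.\<close>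
  let ?A = "insert (0, 2) (Z \<times> {0, 1 :: int})"
  show "?A \<subseteq> Z \<times> Z" using p_ge_5 by auto
  show "card ?A = 2 * p + 1" by (subst card_insert_disjoint) (auto simp: card_cartesian_product)
  have "restricted_sumset (Zp2 p) ?A \<subseteq> Z \<times> {0, 1, 2, 3}"
    using p_ge_5 by (auto simp: restricted_sumset_def mult_Zp2)
  then have "card (restricted_sumset (Zp2 p) ?A) \<le> card (Z \<times> {0, 1, 2, 3 :: int})"
    by (intro card_mono) auto
  then show "card (restricted_sumset (Zp2 p) ?A) \<le> 4 * p" by (simp add: card_cartesian_product)
qed

end

theorem theorem1p4:
  fixes p :: nat
  assumes "Factorial_Ring.prime p" and "p \<ge> 5"
  shows "rho (Zp2 p) (2 * p + 1) = 4 * p"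
proof -
  interpret prime_ge_5 p by unfold_locales (fact assms)+
  obtain A where A: "A \<subseteq> Z \<times> Z" "card A = 2 * p + 1" "card (restricted_sumset (Zp2 p) A) \<le> 4 * p"
    by (rule ex_restricted_sumset_le)
  have "finite A" using A(1) by (rule finite_subset) auto
  show ?thesis
    unfolding rho_def
  proof (rule Min_eqI[OF finite_rho_values])
    show "4 * p \<in> {card (restricted_sumset (Zp2 p) A) | A.
        A \<subseteq> carrier (Zp2 p) \<and> finite A \<and> card A = 2 * p + 1}"
      using A card_restricted_sumset_ge[OF A(1,2)] \<open>finite A\<close> unfolding carrier_Zp2
      by (intro CollectI exI[of _ A]) auto
    show "4 * p \<le> m" if "m \<in> {card (restricted_sumset (Zp2 p) A) | A.
        A \<subseteq> carrier (Zp2 p) \<and> finite A \<and> card A = 2 * p + 1}" for m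
      using that card_restricted_sumset_ge unfolding carrier_Zp2 by blast
  qed
qed

end
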